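(* Let $P_4$ and $P_6$ be the regular $4$-gon and the regular $6$-gon inscribed in the unit circle centered at the origin of the Euclidean plane. Then their Banach-Mazur distance is $\delta_{BM}(P_4, P_6) = \frac{3}{2}$.
   Context: $\mathcal{M}^2$ denotes the family of all centrally symmetric convex bodies (compact convex sets with non-empty interior) of the Euclidean plane $E^2$ centered at the origin $o$. For $K \in \mathcal{M}^2$ and $\lambda > 0$, $\lambda K$ is the image of $K$ under the homothety with center $o$ and ratio $\lambda$. The Banach-Mazur distance of $C, D \in \mathcal{M}^2$ is $\delta_{BM}(C,D) = \inf_{a,\lambda}\{\lambda : a(C) \subset D \subset \lambda a(C)\}$, where $a$ ranges over affine transformations of $E^2$ and $\lambda$ over positive reals. $P_n$ denotes the regular $n$-gon with vertices $(\cos\frac{2j}{n}\pi, \sin\frac{2j}{n}\pi)$ for $j = 0, \dots, n-1$. *)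

theory Defs
  imports "HOL-Analysis.Analysis"
begin

definition affine_transformation :: "(real^2 \<Rightarrow> real^2) \<Rightarrow> bool" where
  "affine_transformation a \<longleftrightarrow> (\<exists>L b. linear L \<and> bij L \<and> a = (\<lambda>x. L x + b))"

(* Intended for centrally symmetric convex bodies centered at 0. For these the set below is
   nonempty, and 0 is a lower bound, so the real Inf is the actual infimum. *)
definition banach_mazur_distance :: "(real^2) set \<Rightarrow> (real^2) set \<Rightarrow> real" where
  "banach_mazur_distance C D =
     Inf {l. l > 0 \<and> (\<exists>a. affine_transformation a \<and> a ` C \<subseteq> D \<and> D \<subseteq> (\<lambda>x. l *\<^sub>R x) ` (a ` C))}"

definition regular_polygon :: "nat \<Rightarrow> (real^2) set" where
  "regular_polygon n =
     convex hull ((\<lambda>j. vector [cos (2 * real j / real n * pi), sin (2 * real j / real n * pi)]) ` {..<n})"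

end

theory Submission
  imports Defs
begin

text \<open>
  Let \<open>x\<close>, \<open>y\<close> be coordinates with respect to two adjacent vertices of the hexagon and put
  \<open>z = - (x + y)\<close>; the hexagon is then \<open>|x|, |y|, |z| \<le> 1\<close>. By symmetry the translation part of the
  affine map may be dropped, so the map is given by the images \<open>u\<close>, \<open>v\<close> of two adjacent vertices
  of the square. The image of the square lies in the hexagon iff all coordinates \<open>u\<^sub>i\<close>, \<open>v\<^sub>i\<close> are at
  most 1 in absolute value, and by Cramer's rule its \<open>l\<close>-fold multiple contains the hexagon iff
  \<open>|u\<^sub>i| + |v\<^sub>i| \<le> l |det (u, v)|\<close> for \<open>i = 1, 2, 3\<close>. The lower bound therefore reduces to
  \<open>3 |det (u, v)| \<le> 2 max\<^sub>i (|u\<^sub>i| + |v\<^sub>i|)\<close>, which follows by distinguishing which two coordinates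
  of \<open>u\<close> and of \<open>v\<close> have equal sign. Equality holds for \<open>u = (1/3, 2/3, -1)\<close> and
  \<open>v = (-1, 2/3, 1/3)\<close>.
\<close>

section \<open>The determinant inequality\<close>

text \<open>The parameters describe \<open>u = (1 - p, p, -1)\<close> and
  \<open>v = (-1, q, 1 - q)\<close>, whose determinant is \<open>p + q - p * q\<close>. The split is
  on the smaller parameter, at 1/2 and 2/3; for the least admissible \<open>M\<close>, equality
  occurs at (1/2, 1) and at (2/3, 2/3).\<close>

lemma product_bound_unit:
  fixes p q M :: real
  assumes p: "0 \<le> p" "p \<le> 1" and q: "0 \<le> q" "q \<le> 1"
    and M: "2 - p \<le> M" "2 - q \<le> M" "p + q \<le> M"
  shows "3 * (p + q - p * q) \<le> 2 * M"
proof -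
  have *: "3 * (x + y - x * y) \<le> 2 * M"
    if "0 \<le> x" "x \<le> y" "y \<le> 1" "2 - x \<le> M" "x + y \<le> M" for x y
  proof (cases "x \<le> 1/2")
    case True
    have "(1 - y) * (1 - x) \<ge> 0" using that by simp
    then have "3 * (x + y - x * y) \<le> 3" by (simp add: algebra_simps)
    also have "3 \<le> 2 * M" using True that by linarith
    finally show ?thesis .
  next
    case large: False
    show ?thesis
    proof (cases "x \<le> 2/3")
      case True
      show ?thesis
      proof (rule ccontr)
        assume "\<not> ?thesis"
        \<comment> \<open>A failure of the claim bounds \<open>y\<close> from below through
          \<open>2 - x \<le> M\<close> and from above through \<open>x + y \<le> M\<close>.
          Eliminating \<open>y\<close> leaves a quadratic in \<open>x\<close> with roots 1/2 and
          2/3, which is not positive between them.\<close>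
        then have a: "4 - 5 * x < y * (3 * (1 - x))" and b: "y * (3 * x - 1) < x"
          using that by (auto simp: algebra_simps)
        have "(4 - 5 * x) * (3 * x - 1) \<le> y * (3 * (1 - x)) * (3 * x - 1)"
          using a large by (intro mult_right_mono) auto
        also have "\<dots> = y * (3 * x - 1) * (3 * (1 - x))" by simp
        also have "\<dots> < x * (3 * (1 - x))"
          using b True by (intro mult_strict_right_mono) auto
        finally have "0 < (2 * x - 1) * (3 * x - 2)" by (simp add: algebra_simps)
        moreover have "(2 * x - 1) * (3 * x - 2) \<le> 0"
          using True large by (intro mult_nonneg_nonpos) auto
        ultimately show False by simp
      qed
    next
      case False
      \<comment> \<open>This bounds \<open>x * y\<close> below by its linearization at the equality
        point (2/3, 2/3); the rest is \<open>x + y \<ge> 4/3\<close>.\<close>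
      have "(x - 2/3) * (y - 2/3) \<ge> 0" using False that by simp
      then have "3 * (x * y) \<ge> 2 * x + 2 * y - 4/3" by (simp add: algebra_simps)
      then show ?thesis using False that by (simp add: algebra_simps)
    qed
  qed
  show ?thesis
  proof (cases "p \<le> q")
    case True
    then show ?thesis using * assms by auto
  next
    case False
    then show ?thesis using *[of q p] assms by (simp add: algebra_simps)
  qed
qed

text \<open>The critical sign pattern: coordinates 1, 2 of \<open>u\<close> and 2, 3 of
  \<open>v\<close> are nonnegative. With \<open>u3 = - (u1 + u2)\<close> and
  \<open>v1 = - (v2 + v3)\<close>, the expression is the determinant
  \<open>u1 * v2 - u2 * v1\<close>.\<close>

lemma det_bound_crossed:
  fixes u1 u2 v2 v3 M :: real
  assumes u: "0 \<le> u1" "0 \<le> u2" "u1 + u2 \<le> 1" and v: "0 \<le> v2" "0 \<le> v3" "v2 + v3 \<le> 1"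
    and M: "u1 + (v2 + v3) \<le> M" "u2 + v2 \<le> M" "(u1 + u2) + v3 \<le> M"
  shows "3 * (u1 * v2 + u2 * (v2 + v3)) \<le> 2 * M"
proof -
  \<comment> \<open>Normalizing to \<open>u1 + u2 = v2 + v3 = 1\<close> only sharpens the claim, because \<open>a b \<le> a\<close> and \<open>a b \<le> b\<close>.\<close>
  define a b where "a = u1 + u2" and "b = v2 + v3"
  show ?thesis
  proof (cases "a = 0 \<or> b = 0")
    case True
    then have "u1 = 0 \<and> u2 = 0 \<or> v2 = 0 \<and> v3 = 0"
      using u v unfolding a_def b_def by auto
    then show ?thesis using u v M by auto
  next
    case False
    then have pos: "0 < a" "0 < b" and le: "a \<le> 1" "b \<le> 1"
      using u v unfolding a_def b_def by auto
    define p q where "p = u2 / a" and "q = v2 / b"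
    have eq: "u2 = a * p" "v2 = b * q" "u1 = a * (1 - p)" "v3 = b * (1 - q)"
      using pos by (auto simp: p_def q_def a_def b_def field_simps)
    have p: "0 \<le> p" "p \<le> 1" and q: "0 \<le> q" "q \<le> 1"
      using u v pos by (auto simp: p_def q_def a_def b_def field_simps)
    have shrink: "a * b * x \<le> a * x" "a * b * x \<le> b * x" if "0 \<le> x" for x
      using that pos le by (auto intro!: mult_right_mono simp: mult_left_le mult_left_le_one_le)
    have "a * b * (2 - p) \<le> M"
      using M(1) shrink(1)[of "1 - p"] shrink(2)[of 1] p eq
      by (simp add: algebra_simps)
    moreover have "a * b * (2 - q) \<le> M"
      using M(3) shrink(2)[of "1 - q"] shrink(1)[of 1] q eq
      by (simp add: algebra_simps)
    moreover have "a * b * (p + q) \<le> M"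
      using M(2) shrink(1)[of p] shrink(2)[of q] p q eq by (simp add: algebra_simps)
    ultimately have "3 * (p + q - p * q) \<le> 2 * (M / (a * b))"
      using p q pos by (intro product_bound_unit) (auto simp: field_simps)
    then have "3 * (a * b * (p + q - p * q)) \<le> 2 * M"
      using pos by (simp add: field_simps)
    moreover have "u1 * v2 + u2 * (v2 + v3) = a * b * (p + q - p * q)"
      by (simp add: eq algebra_simps)
    ultimately show ?thesis by simp
  qed
qed

text \<open>If the nonnegative coordinates of \<open>u\<close> and \<open>v\<close> sit in the same
  places, the determinant is at most the product of two sums in [0, 1], hence at most their mean;
  this even gives factor 2 in place of 3/2.\<close>

lemma det_bound_aligned:
  fixes u1 u2 v1 v2 M :: real
  assumes u: "0 \<le> u1" "0 \<le> u2" "u1 + u2 \<le> 1" and v: "0 \<le> v1" "0 \<le> v2" "v1 + v2 \<le> 1"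
    and M: "(u1 + u2) + (v1 + v2) \<le> M"
  shows "3 * \<bar>u1 * v2 - u2 * v1\<bar> \<le> 2 * M"
proof -
  have nn: "0 \<le> u1 * v2" "0 \<le> u2 * v1" "0 \<le> u1 * v1" "0 \<le> u2 * v2" using u v by auto
  have "\<bar>u1 * v2 - u2 * v1\<bar> \<le> (u1 + u2) * (v1 + v2)"
    using nn by (simp add: algebra_simps)
  moreover have "(u1 + u2) * (v1 + v2) \<le> u1 + u2" "(u1 + u2) * (v1 + v2) \<le> v1 + v2"
    using u v by (simp_all add: mult_left_le mult_left_le_one_le)
  ultimately have "2 * \<bar>u1 * v2 - u2 * v1\<bar> \<le> M" using M by argo
  moreover have "3 * x \<le> 2 * M" if "2 * x \<le> M" "0 \<le> x" for x using that by linarith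
  ultimately show ?thesis using abs_ge_zero by blast
qed

text \<open>Two of the three coordinates of \<open>v\<close> agree in sign, and replacing
  \<open>v\<close> by \<open>- v\<close> makes them nonnegative. The three positions of the pair
  give one aligned case and two crossed ones, which differ by exchanging coordinates 1 and
  2.\<close>

lemma det_bound_nonneg:
  fixes u1 u2 u3 v1 v2 v3 M :: real
  assumes u: "u1 + u2 + u3 = 0" "0 \<le> u1" "0 \<le> u2" "\<bar>u3\<bar> \<le> 1"
    and v: "v1 + v2 + v3 = 0" "\<bar>v1\<bar> \<le> 1" "\<bar>v2\<bar> \<le> 1" "\<bar>v3\<bar> \<le> 1"
    and M: "\<bar>u1\<bar> + \<bar>v1\<bar> \<le> M" "\<bar>u2\<bar> + \<bar>v2\<bar> \<le> M" "\<bar>u3\<bar> + \<bar>v3\<bar> \<le> M"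
  shows "3 * \<bar>u1 * v2 - u2 * v1\<bar> \<le> 2 * M"
proof -
  have half: "3 * \<bar>u1 * w2 - u2 * w1\<bar> \<le> 2 * M"
    if w: "w1 + w2 + w3 = 0" "\<bar>w1\<bar> \<le> 1" "\<bar>w2\<bar> \<le> 1" "\<bar>w3\<bar> \<le> 1"
      and N: "\<bar>u1\<bar> + \<bar>w1\<bar> \<le> M" "\<bar>u2\<bar> + \<bar>w2\<bar> \<le> M" "\<bar>u3\<bar> + \<bar>w3\<bar> \<le> M"
      and s: "0 \<le> w1 \<and> 0 \<le> w2 \<or> 0 \<le> w2 \<and> 0 \<le> w3 \<or> 0 \<le> w1 \<and> 0 \<le> w3" for w1 w2 w3
    using s
  proof (elim disjE conjE)
    assume "0 \<le> w1" "0 \<le> w2"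
    then show ?thesis using w N u by (intro det_bound_aligned) auto
  next
    assume nn: "0 \<le> w2" "0 \<le> w3"
    have w1: "w1 = - (w2 + w3)" using w by simp
    have "3 * (u1 * w2 + u2 * (w2 + w3)) \<le> 2 * M"
      by (rule det_bound_crossed; use nn w N u in linarith)
    moreover have "0 \<le> u1 * w2 + u2 * (w2 + w3)" using nn u by simp
    ultimately show ?thesis unfolding w1 by (simp add: algebra_simps)
  next
    assume nn: "0 \<le> w1" "0 \<le> w3"
    have w2: "w2 = - (w1 + w3)" using w by simp
    have "3 * (u2 * w1 + u1 * (w1 + w3)) \<le> 2 * M"
      by (rule det_bound_crossed; use nn w N u in linarith)
    moreover have "0 \<le> u2 * w1 + u1 * (w1 + w3)" using nn u by simp
    moreover have "\<bar>u1 * w2 - u2 * w1\<bar> = \<bar>u2 * w1 + u1 * (w1 + w3)\<bar>"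
      unfolding w2 by (simp add: algebra_simps)
    ultimately show ?thesis by simp
  qed
  consider "0 \<le> v1 \<and> 0 \<le> v2 \<or> 0 \<le> v2 \<and> 0 \<le> v3 \<or> 0 \<le> v1 \<and> 0 \<le> v3"
    | "0 \<le> - v1 \<and> 0 \<le> - v2 \<or> 0 \<le> - v2 \<and> 0 \<le> - v3 \<or> 0 \<le> - v1 \<and> 0 \<le> - v3"
    by linarith
  then show ?thesis
  proof cases
    case 1
    then show ?thesis using half v M by blast
  next
    case 2
    have "3 * \<bar>u1 * (- v2) - u2 * (- v1)\<bar> \<le> 2 * M"
      by (rule half[of _ _ "- v3"]; (rule 2 | (use v(1) in linarith) | simp add: v(2-) M))
    then show ?thesis by (simp add: abs_minus_commute)
  qed
qed

text \<open>Since the coordinates sum to 0, the determinant is invariant under cyclic shifts of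
  them. A shift and possibly a change of sign of \<open>u\<close> make its first two coordinates
  nonnegative.\<close>

lemma det_bound:
  fixes u1 u2 u3 v1 v2 v3 M :: real
  assumes u: "u1 + u2 + u3 = 0" "\<bar>u1\<bar> \<le> 1" "\<bar>u2\<bar> \<le> 1" "\<bar>u3\<bar> \<le> 1"
    and v: "v1 + v2 + v3 = 0" "\<bar>v1\<bar> \<le> 1" "\<bar>v2\<bar> \<le> 1" "\<bar>v3\<bar> \<le> 1"
    and M: "\<bar>u1\<bar> + \<bar>v1\<bar> \<le> M" "\<bar>u2\<bar> + \<bar>v2\<bar> \<le> M" "\<bar>u3\<bar> + \<bar>v3\<bar> \<le> M"
  shows "3 * \<bar>u1 * v2 - u2 * v1\<bar> \<le> 2 * M"
proof -
  have half: "3 * \<bar>w1 * v2 - w2 * v1\<bar> \<le> 2 * M"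
    if w: "w1 + w2 + w3 = 0" "\<bar>w1\<bar> \<le> 1" "\<bar>w2\<bar> \<le> 1" "\<bar>w3\<bar> \<le> 1"
      and N: "\<bar>w1\<bar> + \<bar>v1\<bar> \<le> M" "\<bar>w2\<bar> + \<bar>v2\<bar> \<le> M" "\<bar>w3\<bar> + \<bar>v3\<bar> \<le> M"
      and s: "0 \<le> w1 \<and> 0 \<le> w2 \<or> 0 \<le> w2 \<and> 0 \<le> w3 \<or> 0 \<le> w1 \<and> 0 \<le> w3" for w1 w2 w3
  proof -
    have w3: "w3 = - (w1 + w2)" and v3: "v3 = - (v1 + v2)" using w v by simp_all
    have "w2 * v3 - w3 * v2 = w1 * v2 - w2 * v1" "w3 * v1 - w1 * v3 = w1 * v2 - w2 * v1"
      unfolding w3 v3 by (simp_all add: algebra_simps)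
    then have rot: "3 * \<bar>w1 * v2 - w2 * v1\<bar> \<le> 2 * M"
      if "3 * \<bar>w2 * v3 - w3 * v2\<bar> \<le> 2 * M \<or> 3 * \<bar>w3 * v1 - w1 * v3\<bar> \<le> 2 * M"
      using that by presburger
    show ?thesis
      using s
    proof (elim disjE conjE)
      assume "0 \<le> w1" "0 \<le> w2"
      then show ?thesis using w v N by (intro det_bound_nonneg[of w1 w2 w3 v1 v2 v3 M])
    next
      assume nn: "0 \<le> w2" "0 \<le> w3"
      show ?thesis
        by (rule rot, rule disjI1, rule det_bound_nonneg[of w2 w3 w1 v2 v3 v1 M])
          (use nn w v N in linarith)+
    next
      assume nn: "0 \<le> w1" "0 \<le> w3"
      show ?thesis
        by (rule rot, rule disjI2, rule det_bound_nonneg[of w3 w1 w2 v3 v1 v2 M])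
          (use nn w v N in linarith)+
    qed
  qed
  consider "0 \<le> u1 \<and> 0 \<le> u2 \<or> 0 \<le> u2 \<and> 0 \<le> u3 \<or> 0 \<le> u1 \<and> 0 \<le> u3"
    | "0 \<le> - u1 \<and> 0 \<le> - u2 \<or> 0 \<le> - u2 \<and> 0 \<le> - u3 \<or> 0 \<le> - u1 \<and> 0 \<le> - u3"
    by linarith
  then show ?thesis
  proof cases
    case 1
    then show ?thesis using half u M by blast
  next
    case 2
    have "3 * \<bar>(- u1) * v2 - (- u2) * v1\<bar> \<le> 2 * M"
      by (rule half[of _ _ "- u3"]; (rule 2 | (use u(1) in linarith) | simp add: u(2-) M))
    then show ?thesis by (simp add: abs_minus_commute)
  qed
qed

section \<open>Vertices and bounding half-planes of the two polygons\<close>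

lemma regular_polygon_4:
  "regular_polygon 4 = convex hull {vector [1, 0], vector [0, 1], vector [-1, 0], vector [0, -1]}"
proof -
  have "2 * 3 / 4 * pi = pi / 2 + pi" by simp
  then have 3: "cos (2 * 3 / 4 * pi) = 0" "sin (2 * 3 / 4 * pi) = -1"
    by (simp_all only: cos_periodic_pi sin_periodic_pi) simp_all
  have "{..<4::nat} = {0, 1, 2, 3}" by auto
  then show ?thesis
    unfolding regular_polygon_def using 3 by (simp add: insert_commute)
qed

lemma regular_polygon_6:
  "regular_polygon 6 = convex hull
     {vector [1, 0], vector [1/2, sqrt 3 / 2], vector [-1/2, sqrt 3 / 2],
      vector [-1, 0], vector [-1/2, - sqrt 3 / 2], vector [1/2, - sqrt 3 / 2]}"
proof -
  have e: "2 * 1 / 6 * pi = pi / 3" "2 * 2 / 6 * pi = pi - pi / 3"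
    "2 * 4 / 6 * pi = pi / 3 + pi" "2 * 5 / 6 * pi = 2 * pi - pi / 3"
    by simp_all
  have c: "cos (2 * 1 / 6 * pi) = 1/2" "cos (2 * 2 / 6 * pi) = -1/2"
    "cos (2 * 4 / 6 * pi) = -1/2" "cos (2 * 5 / 6 * pi) = 1/2"
    unfolding e cos_pi_minus cos_periodic_pi cos_2pi_minus cos_60 by simp_all
  have s: "sin (2 * 1 / 6 * pi) = sqrt 3 / 2" "sin (2 * 2 / 6 * pi) = sqrt 3 / 2"
    "sin (2 * 4 / 6 * pi) = - sqrt 3 / 2" "sin (2 * 5 / 6 * pi) = - sqrt 3 / 2"
    unfolding e sin_pi_minus sin_periodic_pi sin_2pi_minus sin_60 by simp_all
  have r: "{..<6::nat} = {0, 1, 2, 3, 4, 5}" by auto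
  show ?thesis
    unfolding regular_polygon_def r image_insert image_empty
    unfolding of_nat_numeral of_nat_1 of_nat_0 c s by simp
qed

lemma vector_add_2: "vector [a, b] + vector [c, d] = (vector [a + c, b + d] :: real^2)"
  by (simp add: vec_eq_iff forall_2)

lemma vector_scale_2: "r *\<^sub>R vector [a, b] = (vector [r * a, r * b] :: real^2)"
  by (simp add: vec_eq_iff forall_2)

lemma convex_hull_inner_le:
  assumes "x \<in> convex hull S" and "\<And>y. y \<in> S \<Longrightarrow> a \<bullet> y \<le> c"
  shows "a \<bullet> x \<le> c"
proof -
  have "convex hull S \<subseteq> {x. a \<bullet> x \<le> c}"
    using assms(2) by (intro hull_minimal convex_halfspace_le) auto
  then show ?thesis using assms(1) by auto
qed

lemma regular_polygon_4_bound:
  assumes "x \<in> regular_polygon 4"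
  shows "\<bar>x $ 1\<bar> + \<bar>x $ 2\<bar> \<le> 1"
proof -
  have "vector [s, t] \<bullet> x \<le> 1" if "\<bar>s\<bar> \<le> 1" "\<bar>t\<bar> \<le> 1" for s t
    using that by (intro convex_hull_inner_le[OF assms[unfolded regular_polygon_4]])
      (auto simp: inner_vec_def sum_2)
  from this[of 1 1] this[of 1 "-1"] this[of "-1" 1] this[of "-1" "-1"]
  show ?thesis by (simp add: inner_vec_def sum_2)
qed

text \<open>Coordinates with respect to two adjacent vertices of the hexagon.\<close>

definition hex_x :: "real^2 \<Rightarrow> real" where
  "hex_x z = z $ 1 - z $ 2 / sqrt 3"

definition hex_y :: "real^2 \<Rightarrow> real" where
  "hex_y z = 2 * z $ 2 / sqrt 3"

lemma linear_hex_x: "linear hex_x"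
  by (rule linearI) (auto simp: hex_x_def add_divide_distrib algebra_simps)

lemma linear_hex_y: "linear hex_y"
  by (rule linearI) (auto simp: hex_y_def add_divide_distrib algebra_simps)

lemma regular_polygon_6_bound:
  assumes "z \<in> regular_polygon 6"
  shows "\<bar>hex_x z\<bar> \<le> 1" "\<bar>hex_y z\<bar> \<le> 1" "\<bar>- (hex_x z + hex_y z)\<bar> \<le> 1"
proof -
  \<comment> \<open>The six outer normals of the sides, scaled to value 1 there; they represent the
    forms \<open>hex_x\<close>, \<open>hex_y\<close>, \<open>hex_x + hex_y\<close> and their
    negatives.\<close>
  have b: "a \<bullet> z \<le> 1" if "a \<in> {vector [1, -1/sqrt 3], vector [-1, 1/sqrt 3], vector [0, 2/sqrt 3],
    vector [0, -2/sqrt 3], vector [1, 1/sqrt 3], vector [-1, -1/sqrt 3]}" for a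
    using that by (intro convex_hull_inner_le[OF assms[unfolded regular_polygon_6]])
      (auto simp: inner_vec_def sum_2)
  show "\<bar>hex_x z\<bar> \<le> 1"
    using b[of "vector [1, -1/sqrt 3]"] b[of "vector [-1, 1/sqrt 3]"]
    unfolding inner_vec_def sum_2 hex_x_def by (simp add: abs_le_iff del: divide_le_eq_1_pos)
  show "\<bar>hex_y z\<bar> \<le> 1"
    using b[of "vector [0, -2/sqrt 3]"] b[of "vector [0, 2/sqrt 3]"]
    unfolding inner_vec_def sum_2 hex_y_def by (simp add: abs_le_iff del: divide_le_eq_1_pos)
  show "\<bar>- (hex_x z + hex_y z)\<bar> \<le> 1"
    using b[of "vector [1, 1/sqrt 3]"] b[of "vector [-1, -1/sqrt 3]"]
    unfolding inner_vec_def sum_2 hex_x_def hex_y_def by (simp add: abs_le_iff del: divide_le_eq_1_pos)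
qed

section \<open>Lower bound for the distance\<close>

lemma distance_lower_bound:
  assumes l: "l > 0" and a: "affine_transformation a"
    and in6: "a ` regular_polygon 4 \<subseteq> regular_polygon 6"
    and out6: "regular_polygon 6 \<subseteq> (\<lambda>x. l *\<^sub>R x) ` (a ` regular_polygon 4)"
  shows "3 / 2 \<le> l"
proof -
  obtain L b where L: "linear L" and a_eq: "a = (\<lambda>x. L x + b)"
    using a unfolding affine_transformation_def by auto
  define U V where "U = L (vector [1, 0])" and "V = L (vector [0, 1])"
  have L_eq: "L c = c $ 1 *\<^sub>R U + c $ 2 *\<^sub>R V" for c
  proof -
    have "c = c $ 1 *\<^sub>R vector [1, 0] + c $ 2 *\<^sub>R vector [0, 1]"
      by (simp add: vec_eq_iff forall_2)
    then have "L c = L (c $ 1 *\<^sub>R vector [1, 0] + c $ 2 *\<^sub>R vector [0, 1])" by simp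
    then show ?thesis
      unfolding U_def V_def by (simp only: linear_add[OF L] linear_scale[OF L])
  qed
  have vertices: "U + b \<in> regular_polygon 6" "- U + b \<in> regular_polygon 6"
    "V + b \<in> regular_polygon 6" "- V + b \<in> regular_polygon 6"
  proof -
    have *: "L c + b \<in> regular_polygon 6"
      if "c \<in> {vector [1, 0], vector [0, 1], vector [-1, 0], vector [0, -1]}" for c
      using in6 hull_inc[OF that, of convex] unfolding regular_polygon_4 a_eq by auto
    show "U + b \<in> regular_polygon 6" "- U + b \<in> regular_polygon 6"
      "V + b \<in> regular_polygon 6" "- V + b \<in> regular_polygon 6"
      using *[of "vector [1, 0]"] *[of "vector [-1, 0]"] *[of "vector [0, 1]"] *[of "vector [0, -1]"]
      by (simp_all add: L_eq)
  qed
  note hex_lin = linear_add[OF linear_hex_x] linear_add[OF linear_hex_y]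
    linear_scale[OF linear_hex_x] linear_scale[OF linear_hex_y]
    linear_diff[OF linear_hex_x] linear_diff[OF linear_hex_y]
    linear_neg[OF linear_hex_x] linear_neg[OF linear_hex_y]
  define u1 u2 v1 v2 where "u1 = hex_x U" and "u2 = hex_y U" and "v1 = hex_x V" and "v2 = hex_y V"
  \<comment> \<open>The translation drops out: if \<open>t + s\<close> and \<open>- t + s\<close>
    both lie in [-1, 1], then so does \<open>t\<close>.\<close>
  have uncentre: "\<bar>hex_x W\<bar> \<le> 1" "\<bar>hex_y W\<bar> \<le> 1" "\<bar>- (hex_x W + hex_y W)\<bar> \<le> 1"
    if W: "W + b \<in> regular_polygon 6" "- W + b \<in> regular_polygon 6" for W
  proof -
    have e: "hex_x (W + b) = hex_x W + hex_x b" "hex_x (- W + b) = - hex_x W + hex_x b"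
      "hex_y (W + b) = hex_y W + hex_y b" "hex_y (- W + b) = - hex_y W + hex_y b"
      by (simp_all only: hex_lin)
    show "\<bar>hex_x W\<bar> \<le> 1"
      using W[THEN regular_polygon_6_bound(1)] unfolding e by linarith
    show "\<bar>hex_y W\<bar> \<le> 1"
      using W[THEN regular_polygon_6_bound(2)] unfolding e by linarith
    show "\<bar>- (hex_x W + hex_y W)\<bar> \<le> 1"
      using W[THEN regular_polygon_6_bound(3)] unfolding e by linarith
  qed
  note u = uncentre[OF vertices(1,2), folded u1_def u2_def]
  note v = uncentre[OF vertices(3,4), folded v1_def v2_def]
  define \<Delta> where "\<Delta> = u1 * v2 - u2 * v1"
  \<comment> \<open>Averaging the representations of \<open>h\<close> and \<open>- h\<close> removes the translation;
    Cramer's rule then turns the coefficients into determinants.\<close>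
  have cramer: "\<bar>hex_x h * v2 - hex_y h * v1\<bar> + \<bar>u1 * hex_y h - u2 * hex_x h\<bar> \<le> l * \<bar>\<Delta>\<bar>"
    if h: "h \<in> regular_polygon 6" "- h \<in> regular_polygon 6" for h
  proof -
    obtain c where c: "c \<in> regular_polygon 4" "h = l *\<^sub>R (L c + b)"
      using h(1) out6 unfolding a_eq by auto
    obtain d where d: "d \<in> regular_polygon 4" "- h = l *\<^sub>R (L d + b)"
      using h(2) out6 unfolding a_eq by blast
    define \<alpha> \<beta> where "\<alpha> = (c $ 1 - d $ 1) / 2" and "\<beta> = (c $ 2 - d $ 2) / 2"
    have ab: "\<bar>\<alpha>\<bar> + \<bar>\<beta>\<bar> \<le> 1"
      using regular_polygon_4_bound[OF c(1)] regular_polygon_4_bound[OF d(1)]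
        abs_triangle_ineq4[of "c $ 1" "d $ 1"] abs_triangle_ineq4[of "c $ 2" "d $ 2"]
      unfolding \<alpha>_def \<beta>_def abs_divide by simp
    have x: "hex_x h = l * (\<alpha> * u1 + \<beta> * v1)"
      using arg_cong[OF c(2), of hex_x] arg_cong[OF d(2), of hex_x]
      by (simp add: hex_lin L_eq u1_def v1_def \<alpha>_def \<beta>_def field_simps)
    have y: "hex_y h = l * (\<alpha> * u2 + \<beta> * v2)"
      using arg_cong[OF c(2), of hex_y] arg_cong[OF d(2), of hex_y]
      by (simp add: hex_lin L_eq u2_def v2_def \<alpha>_def \<beta>_def field_simps)
    have "hex_x h * v2 - hex_y h * v1 = l * \<alpha> * \<Delta>" "u1 * hex_y h - u2 * hex_x h = l * \<beta> * \<Delta>"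
      by (simp_all add: x y \<Delta>_def algebra_simps)
    then have "\<bar>hex_x h * v2 - hex_y h * v1\<bar> + \<bar>u1 * hex_y h - u2 * hex_x h\<bar>
        = l * \<bar>\<Delta>\<bar> * (\<bar>\<alpha>\<bar> + \<bar>\<beta>\<bar>)"
      using l by (simp add: abs_mult algebra_simps)
    also have "\<dots> \<le> l * \<bar>\<Delta>\<bar>"
      using ab l by (simp add: mult_left_le)
    finally show ?thesis .
  qed
  have neg: "- vector [x, y] = (vector [- x, - y] :: real^2)" for x y
    by (simp add: vec_eq_iff forall_2)
  \<comment> \<open>One vertex from each opposite pair suffices; those chosen have hexagon
    coordinates (1, 0), (0, 1) and (-1, 1).\<close>
  have bounds: "\<bar>u1\<bar> + \<bar>v1\<bar> \<le> l * \<bar>\<Delta>\<bar>" "\<bar>u2\<bar> + \<bar>v2\<bar> \<le> l * \<bar>\<Delta>\<bar>"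
    "\<bar>- (u1 + u2)\<bar> + \<bar>- (v1 + v2)\<bar> \<le> l * \<bar>\<Delta>\<bar>"
  proof -
    have m: "vector [1, 0] \<in> regular_polygon 6" "- vector [1, 0] \<in> regular_polygon 6"
      "vector [1/2, sqrt 3 / 2] \<in> regular_polygon 6" "- vector [1/2, sqrt 3 / 2] \<in> regular_polygon 6"
      "vector [-1/2, sqrt 3 / 2] \<in> regular_polygon 6" "- vector [-1/2, sqrt 3 / 2] \<in> regular_polygon 6"
      unfolding regular_polygon_6 neg by (rule hull_inc, simp)+
    show "\<bar>u1\<bar> + \<bar>v1\<bar> \<le> l * \<bar>\<Delta>\<bar>" "\<bar>u2\<bar> + \<bar>v2\<bar> \<le> l * \<bar>\<Delta>\<bar>"
      using cramer[OF m(1,2)] cramer[OF m(3,4)] by (simp_all add: hex_x_def hex_y_def)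
    have "\<bar>- v2 - v1\<bar> = \<bar>v1 + v2\<bar>" by linarith
    then show "\<bar>- (u1 + u2)\<bar> + \<bar>- (v1 + v2)\<bar> \<le> l * \<bar>\<Delta>\<bar>"
      unfolding abs_minus_cancel using cramer[OF m(5,6)]
      by (simp add: hex_x_def hex_y_def)
  qed
  have "3 * \<bar>\<Delta>\<bar> \<le> 2 * (l * \<bar>\<Delta>\<bar>)"
    using det_bound[OF _ u _ v bounds] unfolding \<Delta>_def by simp
  \<comment> \<open>Needed to cancel the determinant. If it vanished, \<open>bounds\<close> would
    force \<open>U = V = 0\<close>, and the image of the square would be the single point
    \<open>b\<close>, with \<open>l *\<^sub>R b\<close> equal to two opposite vertices.\<close>
  moreover have "\<Delta> \<noteq> 0"
  proof
    assume "\<Delta> = 0"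
    then have "u1 = 0" "u2 = 0" "v1 = 0" "v2 = 0" using bounds by auto
    then have z: "U = 0" "V = 0"
      by (simp_all add: u1_def u2_def v1_def v2_def hex_x_def hex_y_def vec_eq_iff forall_2)
    have m: "vector [1, 0] \<in> regular_polygon 6" "vector [-1, 0] \<in> regular_polygon 6"
      unfolding regular_polygon_6 by (rule hull_inc, simp)+
    have "a ` regular_polygon 4 \<subseteq> {b}" unfolding a_eq by (auto simp: L_eq z)
    then have "vector [1, 0] = l *\<^sub>R b" "vector [-1, 0] = l *\<^sub>R b"
      using out6 m by blast+
    then show False by (auto simp: vec_eq_iff forall_2)
  qed
  ultimately show ?thesis by simp
qed

section \<open>An optimal map\<close>

lemma distance_attained:
  "\<exists>a. affine_transformation a \<and> a ` regular_polygon 4 \<subseteq> regular_polygon 6 \<and>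
     regular_polygon 6 \<subseteq> (\<lambda>x. (3/2) *\<^sub>R x) ` (a ` regular_polygon 4)"
proof -
  \<comment> \<open>The basis vectors go to the points with hexagon coordinates (1/3, 2/3) and (-1,
    2/3), the equality case. The image of the square is a rectangle with sides parallel to the
    axes.\<close>
  define L :: "real^2 \<Rightarrow> real^2" where
    "L = (\<lambda>z. vector [2/3 * z $ 1 - 2/3 * z $ 2, sqrt 3 / 3 * (z $ 1 + z $ 2)])"
  have L: "linear L"
    by (rule linearI) (auto simp: L_def vec_eq_iff forall_2 add_divide_distrib algebra_simps)
  have "inj L"
    by (rule injI) (simp add: L_def vec_eq_iff forall_2)
  then have "bij L"
    using L linear_injective_imp_surjective by (auto simp: bij_def)
  then have aff: "affine_transformation L"
    unfolding affine_transformation_def using L by (intro exI[of _ L] exI[of _ 0]) auto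
  have conv4: "convex (regular_polygon 4)" and conv6: "convex (regular_polygon 6)"
    by (simp_all add: regular_polygon_4 regular_polygon_6)
  have v4: "vector [1, 0] \<in> regular_polygon 4" "vector [0, 1] \<in> regular_polygon 4"
    "vector [-1, 0] \<in> regular_polygon 4" "vector [0, -1] \<in> regular_polygon 4"
    unfolding regular_polygon_4 by (rule hull_inc, simp)+
  have v6: "vector [1, 0] \<in> regular_polygon 6" "vector [1/2, sqrt 3 / 2] \<in> regular_polygon 6"
    "vector [-1/2, sqrt 3 / 2] \<in> regular_polygon 6" "vector [-1, 0] \<in> regular_polygon 6"
    "vector [-1/2, - sqrt 3 / 2] \<in> regular_polygon 6" "vector [1/2, - sqrt 3 / 2] \<in> regular_polygon 6"
    unfolding regular_polygon_6 by (rule hull_inc, simp)+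
  \<comment> \<open>The corners of the rectangle divide the four slanted sides of the hexagon in the
    ratio 2 : 1.\<close>
  have third: "z \<in> regular_polygon 6"
    if "p \<in> regular_polygon 6" "q \<in> regular_polygon 6" "z = (1/3) *\<^sub>R p + (2/3) *\<^sub>R q" for z p q
    using convexD[OF conv6 that(1,2), of "1/3" "2/3"] that(3) by simp
  have "vector [2/3, sqrt 3 / 3] \<in> regular_polygon 6" "vector [-2/3, sqrt 3 / 3] \<in> regular_polygon 6"
    "vector [-2/3, - sqrt 3 / 3] \<in> regular_polygon 6" "vector [2/3, - sqrt 3 / 3] \<in> regular_polygon 6"
    by (rule third[OF v6(1,2)] third[OF v6(4,3)] third[OF v6(4,5)] third[OF v6(1,6)];
        simp add: vector_add_2 vector_scale_2)+
  then have "L ` {vector [1, 0], vector [0, 1], vector [-1, 0], vector [0, -1]} \<subseteq> regular_polygon 6"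
    by (simp add: L_def)
  then have "L ` regular_polygon 4 \<subseteq> regular_polygon 6"
    unfolding regular_polygon_4 convex_hull_linear_image[OF L]
    by (rule hull_minimal) (rule conv6)
  moreover have "regular_polygon 6 \<subseteq> (\<lambda>x. (3/2) *\<^sub>R x) ` (L ` regular_polygon 4)" (is "_ \<subseteq> ?E")
  proof -
    have conv: "convex ?E"
      by (intro convex_scaling convex_linear_image L conv4)
    \<comment> \<open>All hexagon vertices lie on the boundary of the enlarged rectangle: two at the
      midpoints of its vertical sides (\<open>t = 1/2\<close>), four at the quarter points of its
      horizontal sides (\<open>t = 1/4\<close> and \<open>t = 3/4\<close>).\<close>
    have edge: "z \<in> ?E"
      if "p \<in> regular_polygon 4" "q \<in> regular_polygon 4" "0 \<le> t" "t \<le> 1"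
        "z = (3/2) *\<^sub>R L ((1 - t) *\<^sub>R p + t *\<^sub>R q)" for z p q t
      using convexD[OF conv4 that(1,2), of "1 - t" t] that by auto
    have "{vector [1, 0], vector [1/2, sqrt 3 / 2], vector [-1/2, sqrt 3 / 2], vector [-1, 0],
        vector [-1/2, - sqrt 3 / 2], vector [1/2, - sqrt 3 / 2]} \<subseteq> ?E"
      unfolding insert_subset
      by (intro conjI empty_subsetI
          edge[OF v4(1,4), of "1/2" "vector [1, 0]"]
          edge[OF v4(1,2), of "1/4" "vector [1/2, sqrt 3 / 2]"]
          edge[OF v4(1,2), of "3/4" "vector [-1/2, sqrt 3 / 2]"]
          edge[OF v4(3,2), of "1/2" "vector [-1, 0]"]
          edge[OF v4(3,4), of "1/4" "vector [-1/2, - sqrt 3 / 2]"]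
          edge[OF v4(3,4), of "3/4" "vector [1/2, - sqrt 3 / 2]"])
        (simp_all add: L_def vector_add_2 vector_scale_2)
    then show ?thesis
      unfolding regular_polygon_6 by (rule hull_minimal) (rule conv)
  qed
  ultimately show ?thesis using aff by blast
qed

theorem theorem1:
  shows "banach_mazur_distance (regular_polygon 4) (regular_polygon 6) = 3 / 2"
  unfolding banach_mazur_distance_def
proof (rule cInf_eq_minimum)
  show "3 / 2 \<in> {l. l > 0 \<and> (\<exists>a. affine_transformation a \<and> a ` regular_polygon 4 \<subseteq> regular_polygon 6 \<and>
      regular_polygon 6 \<subseteq> (\<lambda>x. l *\<^sub>R x) ` (a ` regular_polygon 4))}"
    using distance_attained by simp
qed (use distance_lower_bound in blast)

end
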